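(* Let $K$ be a field, let $R=K[x_1,\dots,x_n]$, and let $J$ be an ideal of $R$ such that $I=\operatorname{Rad}(J)$ is a nonzero proper monomial ideal generated by at most $n-1$ (squarefree) monomials. Then $$\operatorname{ara} J\leq n-\frac{n-1}{\tau(I)}.$$
   Context: A monomial ideal is an ideal generated by monomials, i.e. by products of indeterminates; a monomial is squarefree if it is a product of pairwise distinct indeterminates (radical monomial ideals are exactly those generated by squarefree monomials). For an ideal $J$ of $R$, elements $a_1,\dots,a_s\in R$ generate $J$ up to radical if $\operatorname{Rad}(a_1,\dots,a_s)=\operatorname{Rad} J$. The arithmetical rank $\operatorname{ara} J$ is the minimum number $s$ for which such elements exist. $\tau(I)$ denotes the maximum of the heights of the minimal primes of $I$. The inequality is between rational numbers. *)

theory Defs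
  imports
    "HOL-Algebra.Algebraic_Closure_Type"
    "HOL-Library.Cardinality"
    "HOL-Library.Poly_Mapping"
    "HOL-Library.Extended_Nat"
begin

text \<open>
  The indeterminates are indexed by a finite type \<open>'n\<close>, so their number is \<open>CARD('n)\<close>. A polynomial is
  a finitely supported map from exponent vectors to coefficients; multiplication in
  \<^theory>\<open>HOL-Library.Poly_Mapping\<close> is convolution, so this is the polynomial ring.
\<close>

type_synonym ('n, 'k) mpoly = "('n \<Rightarrow>\<^sub>0 nat) \<Rightarrow>\<^sub>0 'k"

abbreviation mpoly_ring :: "('n::finite, 'k::field) mpoly ring" where
  "mpoly_ring \<equiv> ring_of_type_algebra"

definition monomials :: "('n::finite, 'k::field) mpoly set" where
  "monomials = range (\<lambda>e. Poly_Mapping.single e 1)"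

definition rad_ideal :: "('a, 'b) ring_scheme \<Rightarrow> 'a set \<Rightarrow> 'a set" where
  "rad_ideal R J = {a \<in> carrier R. \<exists>k::nat. a [^]\<^bsub>R\<^esub> k \<in> J}"

definition minimal_primes :: "('a, 'b) ring_scheme \<Rightarrow> 'a set \<Rightarrow> 'a set set" where
  "minimal_primes R I =
     {P. primeideal P R \<and> I \<subseteq> P \<and> (\<forall>Q. primeideal Q R \<and> I \<subseteq> Q \<and> Q \<subseteq> P \<longrightarrow> Q = P)}"

definition ideal_height :: "('a, 'b) ring_scheme \<Rightarrow> 'a set \<Rightarrow> enat" where
  "ideal_height R P = Sup {enat k |k. \<exists>C :: nat \<Rightarrow> 'a set.
     (\<forall>i\<le>k. primeideal (C i) R) \<and> (\<forall>i<k. C i \<subset> C (Suc i)) \<and> C k = P}"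

text \<open>
  A supremum of a set of extended naturals that is nonempty and bounded by a natural number is attained,
  so for a proper ideal of a polynomial ring in finitely many indeterminates over a field this is
  the maximum height, and it is finite.
\<close>

definition max_height :: "('a, 'b) ring_scheme \<Rightarrow> 'a set \<Rightarrow> enat" where
  "max_height R I = (SUP P\<in>minimal_primes R I. ideal_height R P)"

definition ara :: "('a, 'b) ring_scheme \<Rightarrow> 'a set \<Rightarrow> nat" where
  "ara R J = (LEAST s. \<exists>as. length as = s \<and> set as \<subseteq> carrier R \<and>
     rad_ideal R (genideal R (set as)) = rad_ideal R J)"

end

theory Submission imports Defs
begin

text \<open>
  Let \<open>I\<close> be generated by \<open>\<mu>\<close> monomials and let \<open>\<tau>\<close> be the maximum of the heights of its minimal
  primes. The theorem follows from the bound \<open>ara J \<le> \<mu> - s\<close> with \<open>s = (\<mu> - 1) div \<tau>\<close>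
  (\<open>ara_monomial_radical_le\<close>): for \<open>\<mu> \<le> n - 1\<close> the right-hand side is at most
  \<open>n - (n - 1) / \<tau>\<close> by rounding.

  Regard the supports of the generators as the edges of a hypergraph whose vertices are the
  indeterminates. An inclusion-minimal vertex cover \<open>Z\<close> generates a minimal prime of \<open>I\<close>, and the
  primes generated by initial segments of \<open>Z\<close> form a chain, so that \<open>card Z \<le> \<tau>\<close>
  (\<open>card_minimal_cover_le_max_height\<close>). Suppose that every generator were divisible by an
  indeterminate that divides at most \<open>s\<close> generators. These indeterminates form a cover; a minimal
  cover inside it has at most \<open>\<tau>\<close> elements and meets at most \<open>\<tau> * s < \<mu>\<close> edges, which is absurd.
  Hence some generator \<open>q\<close> has only indeterminates that divide more than \<open>s\<close> generators each
  (\<open>ex_edge_of_high_degree_vertices\<close>). By counting, any \<open>\<mu> - s\<close> generators have a product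
  divisible by the squarefree part \<open>u\<close> of \<open>q\<close>.

  Now \<open>u\<close> together with the elementary symmetric functions of the generators of the degrees
  \<open>1, \<dots>, \<mu> - s - 1\<close> generates \<open>I\<close> up to radical (\<open>ara_le_of_dvd_products\<close>). The symmetric
  functions of larger degree are multiples of \<open>u\<close>, so all of them lie in the new ideal, and
  each generator, a root of the monic polynomial having them as coefficients, is nilpotent
  modulo that ideal.

  One point remains. The maximum height is an extended natural number, and \<open>card Z \<le> \<tau>\<close> yields a
  bound by \<open>the_enat\<close> only if the heights are bounded. For a strict chain of \<open>k + 1\<close> primes, choose
  \<open>k\<close> elements from the successive differences. They are algebraically independent over the field
  (\<open>chain_monomials_independent\<close>), and comparing the number of their power products with the
  dimension of a space of polynomials of bounded exponents gives \<open>k \<le> n\<close>.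
\<close>

section \<open>Ideals and radicals in a commutative ring given as a type\<close>

lemma pow_ring_of_type [simp]:
  fixes a :: "'a::comm_ring_1"
  shows "a [^]\<^bsub>ring_of_type_algebra\<^esub> (k::nat) = a ^ k"
proof -
  interpret cring "ring_of_type_algebra :: 'a ring" by (rule cring_from_type_algebra)
  show ?thesis
    by (induction k) (simp_all add: ring_of_type_algebra_def nat_pow_def mult.commute)
qed

lemma carrier_ring_of_type [simp]: "carrier ring_of_type_algebra = UNIV"
  by (simp add: ring_of_type_algebra_def)

lemma ideal_of_type_iff:
  fixes J :: "'a::comm_ring_1 set"
  shows "ideal J ring_of_type_algebra \<longleftrightarrow>
    0 \<in> J \<and> (\<forall>a\<in>J. \<forall>b\<in>J. a + b \<in> J) \<and> (\<forall>r. \<forall>a\<in>J. r * a \<in> J)"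
proof -
  interpret cring "ring_of_type_algebra :: 'a ring" by (rule cring_from_type_algebra)
  have sel: "monoid.mult ring_of_type_algebra = (*)" "add ring_of_type_algebra = (+)"
    "zero ring_of_type_algebra = (0::'a)"
    by (simp_all add: ring_of_type_algebra_def fun_eq_iff)
  have neg: "\<ominus>\<^bsub>ring_of_type_algebra\<^esub> x = - x" for x :: 'a
    by (rule minus_equality) (simp_all add: sel)
  show ?thesis
  proof
    assume "ideal J ring_of_type_algebra"
    then interpret ideal J "ring_of_type_algebra :: 'a ring" .
    show "0 \<in> J \<and> (\<forall>a\<in>J. \<forall>b\<in>J. a + b \<in> J) \<and> (\<forall>r. \<forall>a\<in>J. r * a \<in> J)"
      using zero_closed a_closed I_l_closed by (simp add: sel)
  next
    assume J: "0 \<in> J \<and> (\<forall>a\<in>J. \<forall>b\<in>J. a + b \<in> J) \<and> (\<forall>r. \<forall>a\<in>J. r * a \<in> J)"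
    have "- x \<in> J" if "x \<in> J" for x
      using J that by (metis mult_minus1)
    then have "subgroup J (add_monoid ring_of_type_algebra)"
      using J by (intro subgroup.intro) (simp_all only: neg flip: a_inv_def, simp_all add: sel)
    moreover have "a * r \<in> J" if "a \<in> J" for a r
      using J that by (metis mult.commute)
    ultimately show "ideal J ring_of_type_algebra"
      using J by (intro idealI ring_axioms) (auto simp: sel)
  qed
qed

lemma primeideal_of_type_iff:
  fixes P :: "'a::comm_ring_1 set"
  shows "primeideal P ring_of_type_algebra \<longleftrightarrow> ideal P ring_of_type_algebra \<and>
    1 \<notin> P \<and> (\<forall>a b. a * b \<in> P \<longrightarrow> a \<in> P \<or> b \<in> P)"
proof -
  have sel: "monoid.mult ring_of_type_algebra = ((*) :: 'a \<Rightarrow> _)"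
    by (simp add: ring_of_type_algebra_def fun_eq_iff)
  show ?thesis
    unfolding primeideal_def primeideal_axioms_def
    using cring_from_type_algebra[where 'a='a]
    by (auto simp: sel ideal_of_type_iff) (metis mult.right_neutral UNIV_I UNIV_eq_I)
qed

lemma ideal_of_type_sum:
  fixes J :: "'a::comm_ring_1 set"
  assumes "ideal J ring_of_type_algebra" and "\<And>x. x \<in> A \<Longrightarrow> f x \<in> J"
  shows "sum f A \<in> J"
  using assms by (induction A rule: infinite_finite_induct) (auto simp: ideal_of_type_iff)

lemma ideal_of_type_diff:
  fixes J :: "'a::comm_ring_1 set"
  assumes "ideal J ring_of_type_algebra" and "a \<in> J" and "b \<in> J"
  shows "a - b \<in> J"
proof -
  have "a + (-1) * b \<in> J"
    using assms unfolding ideal_of_type_iff by blast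
  then show ?thesis by simp
qed

lemma ideal_of_type_dvd:
  fixes J :: "'a::comm_ring_1 set"
  assumes "ideal J ring_of_type_algebra" and "a \<in> J" and "a dvd b"
  shows "b \<in> J"
  using assms by (auto simp: ideal_of_type_iff dvd_def mult.commute)

lemma genideal_of_type:
  fixes S :: "'a::comm_ring_1 set"
  shows ideal_genideal_of_type: "ideal (genideal ring_of_type_algebra S) ring_of_type_algebra"
    and subset_genideal_of_type: "S \<subseteq> genideal ring_of_type_algebra S"
    and genideal_of_type_least:
      "ideal J ring_of_type_algebra \<Longrightarrow> S \<subseteq> J \<Longrightarrow> genideal ring_of_type_algebra S \<subseteq> J"
proof -
  interpret ring "ring_of_type_algebra :: 'a ring" by (rule ring_from_type_algebra)
  show "ideal (genideal ring_of_type_algebra S) ring_of_type_algebra"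
    by (rule genideal_ideal) simp
  show "S \<subseteq> genideal ring_of_type_algebra S"
    by (rule genideal_self) simp
  show "genideal ring_of_type_algebra S \<subseteq> J" if "ideal J ring_of_type_algebra" "S \<subseteq> J"
    using that by (rule genideal_minimal)
qed

lemma mem_rad_ideal_of_type:
  fixes J :: "'a::comm_ring_1 set"
  shows "a \<in> rad_ideal ring_of_type_algebra J \<longleftrightarrow> (\<exists>k. a ^ k \<in> J)"
  by (simp add: rad_ideal_def)

lemma ideal_rad_ideal_of_type:
  fixes J :: "'a::comm_ring_1 set"
  assumes J: "ideal J ring_of_type_algebra"
  shows "ideal (rad_ideal ring_of_type_algebra J) ring_of_type_algebra"
proof -
  have "\<exists>k. (a + b) ^ k \<in> J" if "a ^ m \<in> J" and "b ^ l \<in> J" for a b and m l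
  proof
    have "of_nat (m + l choose i) * a ^ i * b ^ (m + l - i) \<in> J" for i
    proof (cases "m \<le> i")
      case True
      then have "a ^ m dvd of_nat (m + l choose i) * a ^ i * b ^ (m + l - i)"
        by (simp add: le_imp_power_dvd)
      with J \<open>a ^ m \<in> J\<close> show ?thesis by (rule ideal_of_type_dvd)
    next
      case False
      then have "b ^ l dvd of_nat (m + l choose i) * a ^ i * b ^ (m + l - i)"
        by (simp add: le_imp_power_dvd)
      with J \<open>b ^ l \<in> J\<close> show ?thesis by (rule ideal_of_type_dvd)
    qed
    then show "(a + b) ^ (m + l) \<in> J"
      unfolding binomial_ring using J by (intro ideal_of_type_sum) auto
  qed
  moreover have "\<exists>k. (r * a) ^ k \<in> J" if "a ^ m \<in> J" for r a and m
    using ideal_of_type_dvd[OF J that, of "(r * a) ^ m"] by (auto simp only: power_mult_distrib dvd_triv_right)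
  moreover have "\<exists>k. 0 ^ k \<in> J"
    using J by (intro exI[of _ 1]) (simp add: ideal_of_type_iff)
  ultimately show ?thesis
    unfolding ideal_of_type_iff Ball_def mem_rad_ideal_of_type by blast
qed

section \<open>An upper bound for the arithmetical rank\<close>

text \<open>
  Generators up to radical in the manner of Schmitt and Vogel: all products
  of more than \<open>t\<close> elements of \<open>M\<close> are taken care of by the single element \<open>u\<close>, the shorter ones by
  their symmetric functions. No generator is lost up to radical, because in
  \<open>(\<Prod>b\<in>M. X - b)\<close> every coefficient but the leading one is such a symmetric function, and each
  element of \<open>M\<close> is a root.
\<close>

lemma ara_le_of_dvd_products:
  fixes J M :: "'a::comm_ring_1 set"
  assumes J: "ideal J ring_of_type_algebra"
    and M: "rad_ideal ring_of_type_algebra J = genideal ring_of_type_algebra M" and "finite M"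
    and u: "u \<in> rad_ideal ring_of_type_algebra J"
    and dvd: "\<And>B. B \<subseteq> M \<Longrightarrow> t < card B \<Longrightarrow> u dvd \<Prod>B"
  shows "ara ring_of_type_algebra J \<le> t + 1"
proof -
  let ?rad = "rad_ideal (ring_of_type_algebra :: 'a ring)"
  \<comment> \<open>Up to sign the elementary symmetric functions; with the signs, they are the coefficients of
    the polynomial with roots \<open>M\<close>.\<close>
  define e where "e i = (\<Sum>B | B \<subseteq> M \<and> card B = i. \<Prod>b\<in>B. - b)" for i
  define as where "as = u # map e [1..<Suc t]"
  define A where "A = genideal ring_of_type_algebra (set as)"
  have A: "ideal A ring_of_type_algebra"
    unfolding A_def by (rule ideal_genideal_of_type)
  have radJ: "ideal (?rad J) ring_of_type_algebra"
    using J by (rule ideal_rad_ideal_of_type)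
  have MJ: "M \<subseteq> ?rad J"
    unfolding M by (rule subset_genideal_of_type)
  have asA: "set as \<subseteq> A"
    unfolding A_def by (rule subset_genideal_of_type)
  have e_A: "e i \<in> A" if "i \<ge> 1" for i
  proof (cases "i \<le> t")
    case True
    with that have "e i \<in> e ` {1..<Suc t}" by (intro imageI) simp
    then have "e i \<in> set as" by (simp add: as_def del: upt_Suc)
    with asA show ?thesis by blast
  next
    case False
    have "u dvd (\<Prod>b\<in>B. - b)" if "B \<subseteq> M" "card B = i" for B
      using dvd[of B] that False by (simp add: prod_uminus)
    then have "u dvd e i"
      unfolding e_def by (intro dvd_sum) blast
    moreover have "u \<in> A" using asA by (auto simp: as_def)
    ultimately show ?thesis using ideal_of_type_dvd[OF A] by blast
  qed
  have pow_A: "m ^ card M \<in> A" if "m \<in> M" for m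
  proof -
    have "0 = (\<Prod>b\<in>M. - b + m)"
      using that \<open>finite M\<close> by (subst prod_zero) auto
    also have "\<dots> = (\<Sum>B\<in>Pow M. (\<Prod>b\<in>B. - b) * m ^ (card M - card B))"
      unfolding prod_add[OF \<open>finite M\<close>]
      using finite_subset[OF _ \<open>finite M\<close>] by (intro sum.cong) (simp_all add: card_Diff_subset)
    also have "\<dots> = (\<Sum>i\<le>card M. \<Sum>B | B \<in> Pow M \<and> card B = i. (\<Prod>b\<in>B. - b) * m ^ (card M - card B))"
      using \<open>finite M\<close> by (intro sum.group[symmetric]) (auto intro: card_mono)
    also have "\<dots> = (\<Sum>i\<le>card M. e i * m ^ (card M - i))"
      unfolding e_def sum_distrib_right by (intro sum.cong) auto
    also have "\<dots> = e 0 * m ^ card M + (\<Sum>i\<in>{1..card M}. e i * m ^ (card M - i))"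
    proof -
      have "{..card M} = insert 0 {1..card M}" by auto
      then show ?thesis by simp
    qed
    also have "e 0 = 1"
    proof -
      have "{B. B \<subseteq> M \<and> card B = 0} = {{}}"
        using finite_subset[OF _ \<open>finite M\<close>] by (auto simp: card_eq_0_iff)
      then show ?thesis by (simp add: e_def)
    qed
    finally have "m ^ card M = 0 - (\<Sum>i\<in>{1..card M}. e i * m ^ (card M - i))"
      by (simp add: eq_neg_iff_add_eq_0)
    moreover have "(\<Sum>i\<in>{1..card M}. e i * m ^ (card M - i)) \<in> A"
      by (rule ideal_of_type_sum[OF A], rule ideal_of_type_dvd[OF A e_A]) auto
    moreover have "0 \<in> A" using A by (simp add: ideal_of_type_iff)
    ultimately show ?thesis using ideal_of_type_diff[OF A] by metis
  qed
  have e_J: "e i \<in> ?rad J" if "i \<ge> 1" for i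
    unfolding e_def
  proof (rule ideal_of_type_sum[OF radJ])
    fix B assume B: "B \<in> {B. B \<subseteq> M \<and> card B = i}"
    then obtain b where "b \<in> B" using \<open>i \<ge> 1\<close> by fastforce
    then have "b dvd (\<Prod>b\<in>B. - b)"
      using B finite_subset[OF _ \<open>finite M\<close>, of B] by (simp add: prod_uminus dvd_mult dvd_prodI[of B b "\<lambda>x. x"])
    moreover have "b \<in> ?rad J" using \<open>b \<in> B\<close> B MJ by auto
    ultimately show "(\<Prod>b\<in>B. - b) \<in> ?rad J"
      using ideal_of_type_dvd[OF radJ] by blast
  qed
  have "?rad A = ?rad J"
  proof
    have "A \<subseteq> ?rad J"
      unfolding A_def using u e_J by (intro genideal_of_type_least radJ) (auto simp: as_def)
    then show "?rad A \<subseteq> ?rad J"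
      unfolding subset_iff mem_rad_ideal_of_type by (metis power_mult)
    have "M \<subseteq> ?rad A"
      using pow_A unfolding subset_iff mem_rad_ideal_of_type by blast
    then show "?rad J \<subseteq> ?rad A"
      unfolding M by (intro genideal_of_type_least ideal_rad_ideal_of_type A)
  qed
  then show ?thesis
    unfolding ara_def A_def by (intro Least_le exI[of _ as]) (simp add: as_def)
qed

section \<open>Chains of primes in a polynomial ring are bounded\<close>

text \<open>
  A bound on each exponent separately is compatible with products in the same way as a bound
  on the total degree, and the monomials obeying it form a cube, which is easy to count.
\<close>

definition exponents_le :: "nat \<Rightarrow> ('n::finite, 'k::field) mpoly set" where
  "exponents_le b = {p. \<forall>e\<in>Poly_Mapping.keys p. \<forall>x. Poly_Mapping.lookup e x \<le> b}"

lemma exponents_le_one: "1 \<in> exponents_le b"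
  by (simp add: exponents_le_def)

lemma exponents_le_mono: "b \<le> c \<Longrightarrow> exponents_le b \<subseteq> exponents_le c"
  unfolding exponents_le_def using order_trans by blast

lemma exponents_le_mult:
  assumes "p \<in> exponents_le b" and "q \<in> exponents_le c"
  shows "p * q \<in> exponents_le (b + c)"
  using keys_mult[of p q] assms
  by (fastforce simp: exponents_le_def lookup_add intro: add_mono)

lemma exponents_le_power: "p \<in> exponents_le b \<Longrightarrow> p ^ k \<in> exponents_le (k * b)"
  by (induction k) (auto simp: exponents_le_one exponents_le_mult)

lemma exponents_le_prod:
  assumes "finite A" and "\<And>i. i \<in> A \<Longrightarrow> f i \<in> exponents_le b"
  shows "prod f A \<in> exponents_le (card A * b)"
  using assms by (induction A rule: finite_induct) (auto simp: exponents_le_one exponents_le_mult)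

lemma ex_exponents_le: "\<exists>b. p \<in> exponents_le b"
proof
  show "p \<in> exponents_le (\<Sum>e\<in>Poly_Mapping.keys p. \<Sum>x\<in>UNIV. Poly_Mapping.lookup e x)"
    unfolding exponents_le_def
  proof (intro CollectI ballI allI)
    fix e x assume e: "e \<in> Poly_Mapping.keys p"
    have "Poly_Mapping.lookup e x \<le> (\<Sum>x\<in>UNIV. Poly_Mapping.lookup e x)"
      by (intro member_le_sum) auto
    also have "\<dots> \<le> (\<Sum>e\<in>Poly_Mapping.keys p. \<Sum>x\<in>UNIV. Poly_Mapping.lookup e x)"
      using e by (intro member_le_sum[of e _ "\<lambda>e. \<Sum>x\<in>UNIV. Poly_Mapping.lookup e x"]) auto
    finally show "Poly_Mapping.lookup e x \<le> \<dots>" .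
  qed
qed

lemma bounded_exponents:
  fixes b :: nat
  defines "E \<equiv> {e :: 'n::finite \<Rightarrow>\<^sub>0 nat. \<forall>x. Poly_Mapping.lookup e x \<le> b}"
  shows "finite E" and "card E \<le> (b + 1) ^ CARD('n)"
proof -
  have inj: "inj_on Poly_Mapping.lookup E"
    by (auto intro!: inj_onI poly_mapping_eqI)
  have sub: "Poly_Mapping.lookup ` E \<subseteq> PiE UNIV (\<lambda>_. {..b})"
    by (auto simp: E_def)
  have fin: "finite (PiE (UNIV :: 'n set) (\<lambda>_. {..b}))"
    by (intro finite_PiE) auto
  show "finite E"
    using finite_imageD[OF finite_subset[OF sub fin] inj] .
  have "card E = card (Poly_Mapping.lookup ` E)"
    using inj by (simp add: card_image)
  also have "\<dots> \<le> card (PiE (UNIV :: 'n set) (\<lambda>_. {..b}))"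
    by (rule card_mono[OF fin sub])
  also have "\<dots> = (b + 1) ^ CARD('n)"
    by (simp add: card_PiE)
  finally show "card E \<le> (b + 1) ^ CARD('n)" .
qed

lemma mpoly_eq_sum_monomials:
  fixes p :: "('n::finite, 'k::field) mpoly"
  shows "p = (\<Sum>e\<in>Poly_Mapping.keys p. Poly_Mapping.single e (Poly_Mapping.lookup p e))"
  by (rule poly_mapping_eqI)
    (auto simp: lookup_sum lookup_single when_def sum.delta in_keys_iff)

lemma vector_space_mpoly:
  "vector_space (\<lambda>c (p :: ('n::finite, 'k::field) mpoly). Poly_Mapping.single 0 c * p)"
  by unfold_locales (auto simp: algebra_simps single_add mult_single mult.assoc[symmetric])

text \<open>
  The polynomials with exponents at most \<open>b\<close> are spanned by the monomials with these exponents.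
\<close>

lemma card_le_of_lin_indep:
  fixes v :: "'i \<Rightarrow> ('n::finite, 'k::field) mpoly"
  assumes "finite L" and v: "\<And>l. l \<in> L \<Longrightarrow> v l \<in> exponents_le b"
    and indep: "\<And>c l. (\<Sum>l\<in>L. Poly_Mapping.single 0 (c l) * v l) = 0 \<Longrightarrow> l \<in> L \<Longrightarrow> c l = 0"
  shows "card L \<le> (b + 1) ^ CARD('n)"
proof -
  interpret vector_space "\<lambda>c (p :: ('n, 'k) mpoly). Poly_Mapping.single 0 c * p"
    by (rule vector_space_mpoly)
  define E where "E = {e :: 'n \<Rightarrow>\<^sub>0 nat. \<forall>x. Poly_Mapping.lookup e x \<le> b}"
  define T where "T = (\<lambda>e. Poly_Mapping.single e (1 :: 'k)) ` E"
  have inj: "inj_on v L"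
  proof (rule inj_onI, rule ccontr)
    fix l l' assume l: "l \<in> L" "l' \<in> L" "v l = v l'" "l \<noteq> l'"
    define c :: "'i \<Rightarrow> 'k" where "c = (\<lambda>i. if i = l then 1 else if i = l' then -1 else 0)"
    have "(\<Sum>i\<in>L. Poly_Mapping.single 0 (c i) * v i) =
        (\<Sum>i\<in>{l, l'}. Poly_Mapping.single 0 (c i) * v i)"
      using \<open>finite L\<close> l by (intro sum.mono_neutral_right) (auto simp: c_def)
    also have "\<dots> = 0"
      using l by (simp add: c_def single_uminus)
    finally have "c l = 0" using indep l by blast
    then show False by (simp add: c_def)
  qed
  have "independent (v ` L)"
  proof (rule independent_if_scalars_zero)
    show "finite (v ` L)" using \<open>finite L\<close> by simp
    fix f x assume 0: "(\<Sum>x\<in>v ` L. Poly_Mapping.single 0 (f x) * x) = 0" and "x \<in> v ` L"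
    then obtain l where l: "l \<in> L" "x = v l" by blast
    from 0 have "(\<Sum>l\<in>L. Poly_Mapping.single 0 (f (v l)) * v l) = 0"
      using inj by (simp add: sum.reindex)
    with indep[of "\<lambda>l. f (v l)" l] l show "f x = 0" by simp
  qed
  moreover have "finite T"
    using bounded_exponents(1) by (auto simp: T_def E_def)
  moreover have "v ` L \<subseteq> span T"
  proof
    fix p assume "p \<in> v ` L"
    then have p: "p \<in> exponents_le b" using v by blast
    have "Poly_Mapping.single e (Poly_Mapping.lookup p e) \<in> span T" if "e \<in> Poly_Mapping.keys p" for e
    proof -
      have "Poly_Mapping.single e 1 \<in> span T"
        using p that by (intro span_base) (auto simp: T_def E_def exponents_le_def)
      from span_scale[OF this, of "Poly_Mapping.lookup p e"] show ?thesis
        by (simp add: mult_single)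
    qed
    then show "p \<in> span T"
      by (subst mpoly_eq_sum_monomials) (rule span_sum)
  qed
  ultimately have "card (v ` L) \<le> card T"
    using independent_span_bound by blast
  also have "card T \<le> card E"
    using bounded_exponents(1) by (auto simp: T_def E_def intro: card_image_le)
  also have "\<dots> \<le> (b + 1) ^ CARD('n)"
    unfolding E_def by (rule bounded_exponents(2))
  finally show ?thesis
    using inj by (simp add: card_image)
qed

text \<open>
  If a linear combination of power products of \<open>y 0, y 1, \<dots>\<close> lies in \<open>C 0\<close>, then in its lowest
  power of \<open>y 0\<close> that power can be cancelled, since \<open>y 0 \<notin> C 0\<close>. What is left lies in \<open>C 1\<close>, as do
  all its terms that still contain \<open>y 0\<close>. The remaining part is a combination of power products of
  \<open>y 1, y 2, \<dots>\<close> in \<open>C 1\<close>, to which the induction hypothesis for the shorter chain applies.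
  Exponent vectors are lists so that the exponent of \<open>y 0\<close> can be split off as the head.
\<close>

lemma chain_monomials_independent:
  fixes C :: "nat \<Rightarrow> ('n::finite, 'k::field) mpoly set"
  assumes "\<And>i. i \<le> k \<Longrightarrow> primeideal (C i) mpoly_ring"
    and "\<And>i. i < k \<Longrightarrow> C i \<subseteq> C (Suc i)"
    and "\<And>i. i < k \<Longrightarrow> y i \<in> C (Suc i) - C i"
    and "(\<Sum>xs | length xs = k \<and> set xs \<subseteq> {..<d}.
        Poly_Mapping.single 0 (c xs) * (\<Prod>i<k. y i ^ (xs ! i))) \<in> C 0"
    and "length xs = k" and "set xs \<subseteq> {..<d}"
  shows "c xs = 0"
  using assms
proof (induction k arbitrary: C y c xs)
  case 0
  have "{xs. xs = [] \<and> set xs \<subseteq> {..<d}} = {[]}" by auto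
  with 0 have "Poly_Mapping.single 0 (c []) \<in> C 0" by simp
  moreover have C0: "ideal (C 0) mpoly_ring" "1 \<notin> C 0"
    using 0(1)[of 0] by (simp_all add: primeideal_of_type_iff)
  ultimately have "Poly_Mapping.single 0 (inverse (c [])) * Poly_Mapping.single 0 (c []) \<in> C 0"
    by (auto simp: ideal_of_type_iff)
  with C0 have "c [] = 0"
    by (cases "c [] = 0") (auto simp: mult_single)
  with 0 show ?case by simp
next
  case (Suc k)
  let ?L = "\<lambda>k. {xs. length xs = k \<and> set xs \<subseteq> {..<d}}"
  \<comment> \<open>The coefficient of \<open>y 0 ^ x\<close>.\<close>
  define F where "F x = (\<Sum>xs\<in>?L k. Poly_Mapping.single 0 (c (x # xs)) *
    (\<Prod>i<k. y (Suc i) ^ (xs ! i)))" for x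
  have C0: "ideal (C 0) mpoly_ring" and prime0: "\<And>a b. a * b \<in> C 0 \<Longrightarrow> a \<in> C 0 \<or> b \<in> C 0"
    using Suc.prems(1)[of 0] unfolding primeideal_of_type_iff by blast+
  have C1: "ideal (C 1) mpoly_ring"
    using Suc.prems(1)[of 1] unfolding primeideal_of_type_iff by simp
  have y0: "y 0 \<in> C 1" "y 0 \<notin> C 0" and sub: "C 0 \<subseteq> C 1"
    using Suc.prems(2,3)[of 0] by auto
  have L_Suc: "?L (Suc k) = (\<lambda>(x, xs). x # xs) ` ({..<d} \<times> ?L k)"
    by (auto simp: length_Suc_conv image_iff)
  have inj: "inj_on (\<lambda>(x, xs). x # xs) ({..<d} \<times> ?L k)"
    by (auto intro!: inj_onI)
  have "(\<Sum>xs\<in>?L (Suc k). Poly_Mapping.single 0 (c xs) * (\<Prod>i<Suc k. y i ^ (xs ! i))) =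
      (\<Sum>(x, xs)\<in>{..<d} \<times> ?L k. y 0 ^ x * (Poly_Mapping.single 0 (c (x # xs)) *
        (\<Prod>i<k. y (Suc i) ^ (xs ! i))))"
    unfolding L_Suc sum.reindex[OF inj]
    by (intro sum.cong) (auto simp: prod.lessThan_Suc_shift mult_ac simp del: prod.lessThan_Suc)
  also have "\<dots> = (\<Sum>x<d. y 0 ^ x * F x)"
    unfolding F_def sum_distrib_left by (simp add: sum.cartesian_product)
  finally have F_0: "(\<Sum>x<d. y 0 ^ x * F x) \<in> C 0"
    using Suc.prems(4) by simp
  have zero: "\<forall>xs\<in>?L k. c (x # xs) = 0" if "x < d" for x
    using that
  proof (induction x rule: less_induct)
    case (less x)
    have F0: "F x' = 0" if "x' < x" for x'
      using less.IH[OF that] less.prems that unfolding F_def by (intro sum.neutral) auto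
    have "(\<Sum>x'<d. y 0 ^ x' * F x') = (\<Sum>x'\<in>{x..<d}. y 0 ^ x' * F x')"
      using F0 by (intro sum.mono_neutral_right) (auto simp: not_le)
    also have "\<dots> = y 0 ^ x * (\<Sum>x'\<in>{x..<d}. y 0 ^ (x' - x) * F x')"
      unfolding sum_distrib_left
      by (intro sum.cong) (auto simp: mult.assoc[symmetric] simp flip: power_add)
    finally have "y 0 ^ x * (\<Sum>x'\<in>{x..<d}. y 0 ^ (x' - x) * F x') \<in> C 0"
      using F_0 by simp
    moreover have "y 0 ^ x \<notin> C 0"
      using y0(2) prime0 Suc.prems(1)[of 0]
      by (induction x) (auto simp: primeideal_of_type_iff)
    ultimately have "(\<Sum>x'\<in>{x..<d}. y 0 ^ (x' - x) * F x') \<in> C 1"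
      using prime0 sub by blast
    moreover have "(\<Sum>x'\<in>{x..<d}. y 0 ^ (x' - x) * F x') =
        F x + (\<Sum>x'\<in>{Suc x..<d}. y 0 ^ (x' - x) * F x')"
      using less.prems by (simp add: sum.atLeast_Suc_lessThan)
    moreover have "(\<Sum>x'\<in>{Suc x..<d}. y 0 ^ (x' - x) * F x') \<in> C 1"
    proof (rule ideal_of_type_sum[OF C1])
      fix x' assume "x' \<in> {Suc x..<d}"
      then have "y 0 dvd y 0 ^ (x' - x) * F x'"
        by (intro dvd_mult2 dvd_power) auto
      with C1 y0(1) show "y 0 ^ (x' - x) * F x' \<in> C 1" by (rule ideal_of_type_dvd)
    qed
    ultimately have F_1: "F x \<in> C 1"
      using ideal_of_type_diff[OF C1] by fastforce
    show ?case
    proof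
      fix xs assume xs: "xs \<in> ?L k"
      show "c (x # xs) = 0"
      proof (rule Suc.IH[of "\<lambda>i. C (Suc i)" "\<lambda>i. y (Suc i)" "\<lambda>xs. c (x # xs)"])
        show "(\<Sum>xs\<in>?L k. Poly_Mapping.single 0 (c (x # xs)) *
            (\<Prod>i<k. y (Suc i) ^ (xs ! i))) \<in> C (Suc 0)"
          using F_1 by (simp add: F_def)
      qed (use Suc.prems(1-3) xs in auto)
    qed
  qed
  from Suc.prems(5) obtain x xs' where "xs = x # xs'" "length xs' = k"
    by (auto simp: length_Suc_conv)
  with Suc.prems(6) zero show ?case by auto
qed

text \<open>
  The \<open>d ^ k\<close> power products with exponents below \<open>d\<close> are linearly independent and lie in a
  space whose dimension grows like \<open>d ^ n\<close>, where \<open>n\<close> is the number of indeterminates. For large \<open>d\<close> this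
  forces \<open>k \<le> n\<close>.
\<close>

lemma prime_chain_length_le:
  fixes C :: "nat \<Rightarrow> ('n::finite, 'k::field) mpoly set"
  assumes prime: "\<And>i. i \<le> k \<Longrightarrow> primeideal (C i) mpoly_ring"
    and strict: "\<And>i. i < k \<Longrightarrow> C i \<subset> C (Suc i)"
  shows "k \<le> CARD('n)"
proof (rule ccontr)
  assume "\<not> k \<le> CARD('n)"
  then have k: "Suc CARD('n) \<le> k" by simp
  have "\<forall>i. \<exists>y. i < k \<longrightarrow> y \<in> C (Suc i) - C i"
    using strict by blast
  then obtain y where y: "\<And>i. i < k \<Longrightarrow> y i \<in> C (Suc i) - C i"
    by metis
  have "\<forall>i. \<exists>b. y i \<in> exponents_le b"
    using ex_exponents_le by blast
  then obtain b where b: "\<And>i. y i \<in> exponents_le (b i)"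
    by metis
  define D where "D = (\<Sum>i<k. b i)"
  have D: "y i \<in> exponents_le D" if "i < k" for i
    using b[of i] exponents_le_mono[of "b i" D] that
    by (auto simp: D_def intro: member_le_sum)
  \<comment> \<open>The least value that makes \<open>d ^ n * d\<close> exceed the bound \<open>d ^ n * (k * D + 1) ^ n\<close> obtained below.\<close>
  define d where "d = (k * D + 1) ^ CARD('n) + 1"
  define L where "L = {xs. length xs = k \<and> set xs \<subseteq> {..<d}}"
  have "d ^ Suc CARD('n) \<le> d ^ k"
    using k by (intro power_increasing) (auto simp: d_def)
  also have "d ^ k = card L"
    using card_lists_length_eq[of "{..<d}" k] by (simp add: L_def conj_commute)
  also have "card L \<le> (k * (d * D) + 1) ^ CARD('n)"
  proof (rule card_le_of_lin_indep[where v = "\<lambda>xs. \<Prod>i<k. y i ^ (xs ! i)"])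
    show "finite L"
      using finite_lists_length_eq[of "{..<d}" k] by (simp add: L_def conj_commute)
  next
    fix xs assume "xs \<in> L"
    have "y i ^ (xs ! i) \<in> exponents_le (d * D)" if "i < k" for i
    proof -
      have "xs ! i \<in> set xs"
        using \<open>xs \<in> L\<close> that by (auto simp: L_def)
      then have "xs ! i < d" using \<open>xs \<in> L\<close> by (auto simp: L_def)
      then have "xs ! i * D \<le> d * D" by simp
      then show ?thesis
        using exponents_le_power[OF D[OF that]] exponents_le_mono by blast
    qed
    then have "(\<Prod>i<k. y i ^ (xs ! i)) \<in> exponents_le (card {..<k} * (d * D))"
      by (intro exponents_le_prod) auto
    then show "(\<Prod>i<k. y i ^ (xs ! i)) \<in> exponents_le (k * (d * D))" by simp
  next
    fix c xs
    assume "(\<Sum>xs\<in>L. Poly_Mapping.single 0 (c xs) * (\<Prod>i<k. y i ^ (xs ! i))) = 0"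
      and "xs \<in> L"
    moreover have "0 \<in> C 0"
      using prime[of 0] by (simp add: primeideal_of_type_iff ideal_of_type_iff)
    ultimately show "c xs = 0"
      using prime strict y
      by (intro chain_monomials_independent[of k C y c d xs]) (auto simp: L_def)
  qed
  also have "\<dots> \<le> (d * (k * D + 1)) ^ CARD('n)"
    by (intro power_mono) (auto simp: d_def algebra_simps)
  also have "\<dots> = d ^ CARD('n) * (d - 1)"
  proof -
    have "(k * D + 1) ^ CARD('n) = d - 1" by (simp add: d_def)
    then show ?thesis by (simp only: power_mult_distrib)
  qed
  finally show False
    by (simp add: d_def)
qed

section \<open>Prime ideals generated by indeterminates\<close>

text \<open>
  The ideal generated by the indeterminates in \<open>Z\<close>, described by the monomials that occur in its
  elements; \<open>var_ideal_subset\<close> shows that it is the least ideal containing them.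
\<close>

definition var_ideal :: "'n set \<Rightarrow> ('n::finite, 'k::field) mpoly set" where
  "var_ideal Z = {p. \<forall>e\<in>Poly_Mapping.keys p. Poly_Mapping.keys e \<inter> Z \<noteq> {}}"

definition indet :: "'n \<Rightarrow> ('n::finite, 'k::field) mpoly" where
  "indet x = Poly_Mapping.single (Poly_Mapping.single x 1) 1"

lemma keys_add_nat:
  fixes d e :: "'n \<Rightarrow>\<^sub>0 nat"
  shows "Poly_Mapping.keys (d + e) = Poly_Mapping.keys d \<union> Poly_Mapping.keys e"
  by (auto simp: in_keys_iff lookup_add)

lemma keys_sum_nat:
  fixes f :: "'i \<Rightarrow> 'n \<Rightarrow>\<^sub>0 nat"
  assumes "finite A"
  shows "Poly_Mapping.keys (sum f A) = (\<Union>i\<in>A. Poly_Mapping.keys (f i))"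
  using assms by (induction A rule: finite_induct) (auto simp: keys_add_nat)

lemma ideal_var_ideal: "ideal (var_ideal Z :: ('n::finite, 'k::field) mpoly set) mpoly_ring"
proof -
  have "p + q \<in> var_ideal Z" if "p \<in> var_ideal Z" "q \<in> var_ideal Z" for p q :: "('n, 'k) mpoly"
    using that keys_add[of p q] unfolding var_ideal_def by blast
  moreover have "r * p \<in> var_ideal Z" if "p \<in> var_ideal Z" for p r :: "('n, 'k) mpoly"
    unfolding var_ideal_def
  proof (intro CollectI ballI)
    fix e assume "e \<in> Poly_Mapping.keys (r * p)"
    then obtain d e' where "e = d + e'" "e' \<in> Poly_Mapping.keys p"
      using keys_mult[of r p] by blast
    with that show "Poly_Mapping.keys e \<inter> Z \<noteq> {}"
      by (auto simp: var_ideal_def keys_add_nat)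
  qed
  moreover have "0 \<in> (var_ideal Z :: ('n, 'k) mpoly set)"
    by (simp add: var_ideal_def)
  ultimately show ?thesis
    by (auto simp: ideal_of_type_iff)
qed

text \<open>
  This replaces the choice of leading monomials in the proof that polynomial rings are domains, where
  a monomial order would need an order on the indeterminates. Restricting \<open>A\<close> and \<open>B\<close> to the elements
  of maximal exponent at one indeterminate after the other leaves a single pair in the end: if a
  sum attains both maxima at an indeterminate, then so does each summand.
\<close>

lemma ex_uniquely_represented_sum:
  fixes A B :: "('n::finite \<Rightarrow>\<^sub>0 nat) set"
  assumes "finite A" "A \<noteq> {}" "finite B" "B \<noteq> {}"
  shows "\<exists>a\<in>A. \<exists>b\<in>B. \<forall>a'\<in>A. \<forall>b'\<in>B. a' + b' = a + b \<longrightarrow> a' = a \<and> b' = b"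
proof -
  have "\<exists>a\<in>A. \<exists>b\<in>B. \<forall>a'\<in>A. \<forall>b'\<in>B. a' + b' = a + b \<longrightarrow>
      (\<forall>x\<in>W. Poly_Mapping.lookup a' x = Poly_Mapping.lookup a x \<and>
        Poly_Mapping.lookup b' x = Poly_Mapping.lookup b x)"
    if "finite W" for W
    using that assms
  proof (induction W arbitrary: A B rule: finite_induct)
    case empty
    then show ?case by auto
  next
    case (insert x W)
    define high where "high S = {e \<in> S. Poly_Mapping.lookup e x = Max ((\<lambda>e. Poly_Mapping.lookup e x) ` S)}"
      for S :: "('n \<Rightarrow>\<^sub>0 nat) set"
    have le: "Poly_Mapping.lookup e x \<le> Max ((\<lambda>e. Poly_Mapping.lookup e x) ` S)"
      if "finite S" "e \<in> S" for e and S :: "('n \<Rightarrow>\<^sub>0 nat) set"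
      using that by simp
    have ne: "high S \<noteq> {}" if "finite S" "S \<noteq> {}" for S
    proof -
      have "Max ((\<lambda>e. Poly_Mapping.lookup e x) ` S) \<in> (\<lambda>e. Poly_Mapping.lookup e x) ` S"
        using that by (intro Max_in) auto
      then show ?thesis by (auto simp: high_def)
    qed
    have fin: "finite (high S)" if "finite S" for S
      using that by (simp add: high_def)
    have "\<exists>a\<in>high A. \<exists>b\<in>high B. \<forall>a'\<in>high A. \<forall>b'\<in>high B. a' + b' = a + b \<longrightarrow>
        (\<forall>x\<in>W. Poly_Mapping.lookup a' x = Poly_Mapping.lookup a x \<and>
          Poly_Mapping.lookup b' x = Poly_Mapping.lookup b x)"
      using insert.prems ne fin by (intro insert.IH) simp_all
    then obtain a b where ab: "a \<in> high A" "b \<in> high B"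
      and uniq: "\<forall>a'\<in>high A. \<forall>b'\<in>high B. a' + b' = a + b \<longrightarrow>
        (\<forall>x\<in>W. Poly_Mapping.lookup a' x = Poly_Mapping.lookup a x \<and>
          Poly_Mapping.lookup b' x = Poly_Mapping.lookup b x)"
      by blast
    have "\<forall>z\<in>insert x W. Poly_Mapping.lookup a' z = Poly_Mapping.lookup a z \<and>
        Poly_Mapping.lookup b' z = Poly_Mapping.lookup b z"
      if "a' \<in> A" "b' \<in> B" "a' + b' = a + b" for a' b'
    proof -
      have "Poly_Mapping.lookup a' x + Poly_Mapping.lookup b' x =
          Poly_Mapping.lookup a x + Poly_Mapping.lookup b x"
        using arg_cong[OF that(3), of "\<lambda>e. Poly_Mapping.lookup e x"] by (simp add: lookup_add)
      moreover have "Poly_Mapping.lookup a' x \<le> Poly_Mapping.lookup a x"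
        "Poly_Mapping.lookup b' x \<le> Poly_Mapping.lookup b x"
        using ab le[of A a'] le[of B b'] that insert.prems by (simp_all add: high_def)
      ultimately have x: "Poly_Mapping.lookup a' x = Poly_Mapping.lookup a x"
        "Poly_Mapping.lookup b' x = Poly_Mapping.lookup b x" by linarith+
      then have "a' \<in> high A" "b' \<in> high B"
        using ab that by (simp_all add: high_def)
      with uniq that(3) x show ?thesis by blast
    qed
    moreover have "a \<in> A" "b \<in> B"
      using ab by (simp_all add: high_def)
    ultimately show ?case by blast
  qed
  from this[OF finite_class.finite_UNIV] obtain a b where ab: "a \<in> A" "b \<in> B"
    and agree: "\<forall>a'\<in>A. \<forall>b'\<in>B. a' + b' = a + b \<longrightarrow>
      (\<forall>x\<in>UNIV. Poly_Mapping.lookup a' x = Poly_Mapping.lookup a x \<and>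
        Poly_Mapping.lookup b' x = Poly_Mapping.lookup b x)"
    by blast
  have "a' = a \<and> b' = b" if "a' \<in> A" "b' \<in> B" "a' + b' = a + b" for a' b'
    using agree that by (simp add: poly_mapping_eq_iff fun_eq_iff)
  with ab show ?thesis by blast
qed

lemma lookup_mult_unique_sum:
  fixes p q :: "('n::finite, 'k::field) mpoly"
  assumes uniq: "\<And>a' b'. \<lbrakk>a' \<in> Poly_Mapping.keys p; b' \<in> Poly_Mapping.keys q; a' + b' = a + b\<rbrakk>
      \<Longrightarrow> a' = a \<and> b' = b"
    and "a \<in> Poly_Mapping.keys p" "b \<in> Poly_Mapping.keys q"
  shows "Poly_Mapping.lookup (p * q) (a + b) = Poly_Mapping.lookup p a * Poly_Mapping.lookup q b"
proof -
  let ?s = "Poly_Mapping.single" and ?l = "Poly_Mapping.lookup"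
  have "?l (p * q) (a + b) = ?l ((\<Sum>a'\<in>Poly_Mapping.keys p. ?s a' (?l p a')) *
      (\<Sum>b'\<in>Poly_Mapping.keys q. ?s b' (?l q b'))) (a + b)"
    using mpoly_eq_sum_monomials[of p] mpoly_eq_sum_monomials[of q] by simp
  also have "\<dots> = (\<Sum>a'\<in>Poly_Mapping.keys p. \<Sum>b'\<in>Poly_Mapping.keys q.
      (?l p a' * ?l q b' when a' + b' = a + b))"
    by (simp add: sum_product lookup_sum mult_single lookup_single)
  also have "\<dots> = (\<Sum>a'\<in>Poly_Mapping.keys p. \<Sum>b'\<in>Poly_Mapping.keys q.
      (if b' = b then (if a' = a then ?l p a' * ?l q b' else 0) else 0))"
    using uniq by (intro sum.cong refl) (auto simp: when_def)
  also have "\<dots> = ?l p a * ?l q b"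
    using assms(2,3) by (simp add: sum.delta)
  finally show ?thesis .
qed

text \<open>
  If neither \<open>p\<close> nor \<open>q\<close> lies in the ideal, both have terms without indeterminates from \<open>Z\<close>. Among these,
  choose a pair whose sum of exponents is uniquely represented. A product of two terms avoids \<open>Z\<close>
  only if both factors do, so no other terms of \<open>p\<close> and \<open>q\<close> can cancel this one in \<open>p * q\<close>.
\<close>

lemma primeideal_var_ideal:
  "primeideal (var_ideal Z :: ('n::finite, 'k::field) mpoly set) mpoly_ring"
proof -
  have "p * q \<notin> var_ideal Z" if p: "p \<notin> var_ideal Z" and q: "q \<notin> var_ideal Z"
    for p q :: "('n, 'k) mpoly"
  proof -
    define avoid where "avoid r = {e \<in> Poly_Mapping.keys r. Poly_Mapping.keys e \<inter> Z = {}}"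
      for r :: "('n, 'k) mpoly"
    have "avoid p \<noteq> {}" "avoid q \<noteq> {}"
      using p q by (auto simp: var_ideal_def avoid_def)
    moreover have "finite (avoid p)" "finite (avoid q)"
      by (simp_all add: avoid_def)
    ultimately obtain a b where ab: "a \<in> avoid p" "b \<in> avoid q"
      and uniq: "\<And>a' b'. \<lbrakk>a' \<in> avoid p; b' \<in> avoid q; a' + b' = a + b\<rbrakk> \<Longrightarrow> a' = a \<and> b' = b"
      using ex_uniquely_represented_sum by metis
    have sum: "Poly_Mapping.keys (a + b) \<inter> Z = {}"
      using ab by (auto simp: avoid_def keys_add_nat)
    have "a' = a \<and> b' = b"
      if "a' \<in> Poly_Mapping.keys p" "b' \<in> Poly_Mapping.keys q" "a' + b' = a + b" for a' b'
    proof -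
      have "Poly_Mapping.keys a' \<inter> Z = {}" "Poly_Mapping.keys b' \<inter> Z = {}"
        using sum unfolding that(3)[symmetric] keys_add_nat by auto
      with uniq that show ?thesis by (auto simp: avoid_def)
    qed
    then have "Poly_Mapping.lookup (p * q) (a + b) = Poly_Mapping.lookup p a * Poly_Mapping.lookup q b"
      using ab by (intro lookup_mult_unique_sum) (auto simp: avoid_def)
    then have "a + b \<in> Poly_Mapping.keys (p * q)"
      using ab by (simp add: in_keys_iff avoid_def)
    with sum show ?thesis by (auto simp: var_ideal_def)
  qed
  moreover have "1 \<notin> (var_ideal Z :: ('n, 'k) mpoly set)"
    by (simp add: var_ideal_def)
  ultimately show ?thesis
    using ideal_var_ideal unfolding primeideal_of_type_iff by blast
qed

lemma indet_in_var_ideal_iff: "indet x \<in> var_ideal Z \<longleftrightarrow> x \<in> Z"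
  by (simp add: indet_def var_ideal_def)

lemma var_ideal_mono: "Y \<subseteq> Z \<Longrightarrow> var_ideal Y \<subseteq> var_ideal Z"
  by (auto simp: var_ideal_def)

text \<open>
  Adding the elements of \<open>Z\<close> one by one gives a strict chain of primes from the zero ideal to
  the given one.
\<close>

lemma card_le_height_var_ideal:
  "enat (card Z) \<le> ideal_height mpoly_ring (var_ideal Z :: ('n::finite, 'k::field) mpoly set)"
proof -
  obtain f where f: "bij_betw f {0..<card Z} Z"
    using ex_bij_betw_nat_finite[of Z] by auto
  define C where "C i = (var_ideal (f ` {0..<i}) :: ('n, 'k) mpoly set)" for i
  have "C i \<subset> C (Suc i)" if "i < card Z" for i
  proof -
    have "f i \<notin> f ` {0..<i}"
      using f that unfolding bij_betw_def by (auto dest: inj_onD)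
    then have "indet (f i) \<in> C (Suc i) - C i"
      by (simp add: C_def indet_in_var_ideal_iff)
    moreover have "C i \<subseteq> C (Suc i)"
      unfolding C_def by (intro var_ideal_mono image_mono) auto
    ultimately show ?thesis by blast
  qed
  moreover have "C (card Z) = var_ideal Z"
    using f by (simp add: C_def bij_betw_def)
  moreover have "primeideal (C i) mpoly_ring" for i
    unfolding C_def by (rule primeideal_var_ideal)
  ultimately show ?thesis
    unfolding ideal_height_def by (intro Sup_upper) blast
qed

lemma monomial_eq_prod_indet:
  "Poly_Mapping.single e 1 = (\<Prod>x\<in>Poly_Mapping.keys e.
    (indet x :: ('n::finite, 'k::field) mpoly) ^ Poly_Mapping.lookup e x)"
proof -
  have pow: "(indet x :: ('n, 'k) mpoly) ^ k = Poly_Mapping.single (Poly_Mapping.single x k) 1" for x k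
    by (induction k) (simp_all add: indet_def mult_single flip: single_add)
  have prod: "(\<Prod>x\<in>A. Poly_Mapping.single (f x) (1 :: 'k)) = Poly_Mapping.single (\<Sum>x\<in>A. f x) 1"
    if "finite A" for f :: "'n \<Rightarrow> 'n \<Rightarrow>\<^sub>0 nat" and A
    using that by (induction A rule: finite_induct) (simp_all add: mult_single)
  have "e = (\<Sum>x\<in>Poly_Mapping.keys e. Poly_Mapping.single x (Poly_Mapping.lookup e x))"
    by (rule poly_mapping_eqI) (auto simp: lookup_sum lookup_single when_def sum.delta in_keys_iff)
  then show ?thesis
    unfolding pow by (simp add: prod)
qed

lemma prod_indet_dvd_monomial:
  assumes "A \<subseteq> Poly_Mapping.keys e"
  shows "(\<Prod>x\<in>A. indet x) dvd (Poly_Mapping.single e 1 :: ('n::finite, 'k::field) mpoly)"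
  unfolding monomial_eq_prod_indet using assms
  by (intro prod_dvd_prod_subset2) (auto simp: in_keys_iff intro!: dvd_power)

lemma primeideal_contains_indet:
  fixes Q :: "('n::finite, 'k::field) mpoly set"
  assumes Q: "primeideal Q mpoly_ring" and e: "Poly_Mapping.single e 1 \<in> Q"
  shows "\<exists>x\<in>Poly_Mapping.keys e. indet x \<in> Q"
proof -
  have one: "1 \<notin> Q" and prime: "\<And>a b. a * b \<in> Q \<Longrightarrow> a \<in> Q \<or> b \<in> Q"
    using Q unfolding primeideal_of_type_iff by blast+
  have pow: "a \<in> Q" if "a ^ k \<in> Q" for a k
    using that
  proof (induction k)
    case (Suc k)
    with prime[of a "a ^ k"] show ?case by auto
  qed (simp add: one)
  have "\<exists>x\<in>A. f x \<in> Q" if "finite A" "prod f A \<in> Q" for f :: "'n \<Rightarrow> ('n, 'k) mpoly" and A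
    using that
  proof (induction A rule: finite_induct)
    case (insert x A)
    with prime[of "f x" "prod f A"] show ?case by auto
  qed (simp add: one)
  from this[OF finite_keys e[unfolded monomial_eq_prod_indet]]
  obtain x where "x \<in> Poly_Mapping.keys e" "indet x ^ Poly_Mapping.lookup e x \<in> Q"
    by (rule bexE)
  with pow[of "indet x"] show ?thesis by (intro bexI)
qed

lemma var_ideal_subset:
  fixes Q :: "('n::finite, 'k::field) mpoly set"
  assumes Q: "ideal Q mpoly_ring" and Z: "\<And>z. z \<in> Z \<Longrightarrow> indet z \<in> Q"
  shows "var_ideal Z \<subseteq> Q"
proof
  fix p :: "('n, 'k) mpoly"
  assume p: "p \<in> var_ideal Z"
  have "Poly_Mapping.single e (Poly_Mapping.lookup p e) \<in> Q" if "e \<in> Poly_Mapping.keys p" for e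
  proof -
    obtain z where z: "z \<in> Z" "z \<in> Poly_Mapping.keys e"
      using p \<open>e \<in> Poly_Mapping.keys p\<close> by (auto simp: var_ideal_def)
    have "indet z dvd (Poly_Mapping.single e 1 :: ('n, 'k) mpoly)"
      using prod_indet_dvd_monomial[of "{z}" e] z by simp
    also have "\<dots> dvd Poly_Mapping.single 0 (Poly_Mapping.lookup p e) * Poly_Mapping.single e 1"
      by (rule dvd_triv_right)
    also have "\<dots> = Poly_Mapping.single e (Poly_Mapping.lookup p e)"
      by (simp add: mult_single)
    finally show ?thesis
      by (rule ideal_of_type_dvd[OF Q Z[OF z(1)]])
  qed
  then show "p \<in> Q"
    by (subst mpoly_eq_sum_monomials) (rule ideal_of_type_sum[OF Q])
qed

section \<open>Minimal vertex covers and minimal primes\<close>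

text \<open>
  A prime between \<open>I\<close> and the ideal of \<open>Z\<close> contains an indeterminate from each generator, and that
  indeterminate lies in \<open>Z\<close>. For each \<open>z \<in> Z\<close> there is a generator that leaves \<open>z\<close> as the only choice.
\<close>

lemma minimal_prime_of_minimal_cover:
  fixes E :: "('n::finite \<Rightarrow>\<^sub>0 nat) set"
  defines "I \<equiv> genideal mpoly_ring ((\<lambda>e. Poly_Mapping.single e 1) ` E) :: ('n, 'k::field) mpoly set"
  assumes cover: "\<And>e. e \<in> E \<Longrightarrow> Poly_Mapping.keys e \<inter> Z \<noteq> {}"
    and minimal: "\<And>z. z \<in> Z \<Longrightarrow> \<exists>e\<in>E. Poly_Mapping.keys e \<inter> Z = {z}"
  shows "var_ideal Z \<in> minimal_primes mpoly_ring I"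
proof -
  have I_sub: "I \<subseteq> var_ideal Z"
    unfolding I_def using cover
    by (intro genideal_of_type_least ideal_var_ideal) (auto simp: var_ideal_def)
  have gen: "Poly_Mapping.single e 1 \<in> I" if "e \<in> E" for e
    unfolding I_def using that by (intro subsetD[OF subset_genideal_of_type] imageI)
  have "Q = var_ideal Z" if Q: "primeideal Q mpoly_ring" "I \<subseteq> Q" "Q \<subseteq> var_ideal Z" for Q
  proof
    show "var_ideal Z \<subseteq> Q"
    proof (rule var_ideal_subset)
      show "ideal Q mpoly_ring" using Q(1) by (simp add: primeideal_of_type_iff)
    next
      fix z assume "z \<in> Z"
      then obtain e where e: "e \<in> E" "Poly_Mapping.keys e \<inter> Z = {z}"
        using minimal by blast
      obtain x where x: "x \<in> Poly_Mapping.keys e" "indet x \<in> Q"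
        using primeideal_contains_indet[OF Q(1) subsetD[OF Q(2) gen[OF e(1)]]] by blast
      then have "x \<in> Z" using subsetD[OF Q(3) x(2)] by (simp add: indet_in_var_ideal_iff)
      with x e have "x = z" by blast
      with x show "indet z \<in> Q" by simp
    qed
  qed (rule Q(3))
  with I_sub show ?thesis
    unfolding minimal_primes_def
    by (simp add: primeideal_var_ideal)
qed

text \<open>
  Without this bound \<open>the_enat\<close> of the maximum height would be an unspecified number.
\<close>

lemma max_height_neq_infinity:
  fixes I :: "('n::finite, 'k::field) mpoly set"
  shows "max_height mpoly_ring I \<noteq> \<infinity>"
proof -
  have "ideal_height mpoly_ring P \<le> enat CARD('n)" for P :: "('n, 'k) mpoly set"
    unfolding ideal_height_def
  proof (intro Sup_least, clarify)
    fix k and C :: "nat \<Rightarrow> ('n, 'k) mpoly set"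
    assume "\<forall>i\<le>k. primeideal (C i) mpoly_ring" and "\<forall>i<k. C i \<subset> C (Suc i)"
    then show "enat k \<le> enat CARD('n)"
      using prime_chain_length_le[of k C] by simp
  qed
  then have "max_height mpoly_ring I \<le> enat CARD('n)"
    unfolding max_height_def by (intro SUP_least)
  then show ?thesis by (metis infinity_ileE)
qed

lemma card_minimal_cover_le_max_height:
  fixes E :: "('n::finite \<Rightarrow>\<^sub>0 nat) set"
  defines "I \<equiv> genideal mpoly_ring ((\<lambda>e. Poly_Mapping.single e 1) ` E) :: ('n, 'k::field) mpoly set"
  assumes cover: "\<And>e. e \<in> E \<Longrightarrow> Poly_Mapping.keys e \<inter> Z \<noteq> {}"
    and minimal: "\<And>z. z \<in> Z \<Longrightarrow> \<exists>e\<in>E. Poly_Mapping.keys e \<inter> Z = {z}"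
  shows "card Z \<le> the_enat (max_height mpoly_ring I)"
proof -
  have "enat (card Z) \<le> ideal_height mpoly_ring (var_ideal Z :: ('n, 'k) mpoly set)"
    by (rule card_le_height_var_ideal)
  also have "\<dots> \<le> max_height mpoly_ring I"
    unfolding max_height_def I_def using assms
    by (intro SUP_upper minimal_prime_of_minimal_cover)
  also have "\<dots> = enat (the_enat (max_height mpoly_ring I))"
    using max_height_neq_infinity[of I] by (cases "max_height mpoly_ring I") simp_all
  finally show ?thesis by simp
qed

text \<open>
  Otherwise each edge contains a vertex of degree at most \<open>s\<close>. These vertices cover all edges, and
  so does a minimal cover \<open>Z\<close> chosen among them; but at most \<open>\<tau>\<close> vertices of degree at most \<open>s\<close>
  cannot meet more than \<open>\<tau> * s\<close> edges.
\<close>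

lemma ex_edge_of_high_degree_vertices:
  fixes V :: "'e \<Rightarrow> 'n set"
  assumes "finite E"
    and min_cover: "\<And>Z. \<lbrakk>\<And>e. e \<in> E \<Longrightarrow> V e \<inter> Z \<noteq> {}; \<And>z. z \<in> Z \<Longrightarrow> \<exists>e\<in>E. V e \<inter> Z = {z}\<rbrakk>
      \<Longrightarrow> card Z \<le> \<tau>"
    and large: "\<tau> * s < card E"
  shows "\<exists>q\<in>E. \<forall>x\<in>V q. s < card {e \<in> E. x \<in> V e}"
proof (rule ccontr)
  assume "\<not> ?thesis"
  then have "\<forall>q\<in>E. \<exists>x. x \<in> V q \<and> card {e \<in> E. x \<in> V e} \<le> s"
    by (auto simp: not_less)
  then obtain v where v: "\<And>q. q \<in> E \<Longrightarrow> v q \<in> V q \<and> card {e \<in> E. v q \<in> V e} \<le> s"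
    by metis
  define cover where "cover Z \<longleftrightarrow> Z \<subseteq> v ` E \<and> (\<forall>e\<in>E. V e \<inter> Z \<noteq> {})" for Z
  have "cover (v ` E)"
    using v by (auto simp: cover_def)
  then obtain Z where Z: "cover Z" and least: "\<And>Y. cover Y \<Longrightarrow> card Z \<le> card Y"
    using ex_has_least_nat[of cover _ card] by blast
  have finZ: "finite Z"
    using Z \<open>finite E\<close> by (auto simp: cover_def intro: finite_subset)
  have "card Z \<le> \<tau>"
  proof (rule min_cover)
    fix z assume z: "z \<in> Z"
    have "\<not> cover (Z - {z})"
      using least[of "Z - {z}"] card_Diff1_less[OF finZ z] by linarith
    with Z obtain e where "e \<in> E" "V e \<inter> (Z - {z}) = {}"
      by (auto simp: cover_def)
    moreover have "V e \<inter> Z \<noteq> {}"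
      using Z \<open>e \<in> E\<close> by (auto simp: cover_def)
    ultimately show "\<exists>e\<in>E. V e \<inter> Z = {z}" by blast
  qed (use Z in \<open>auto simp: cover_def\<close>)
  have "E = (\<Union>z\<in>Z. {e \<in> E. z \<in> V e})"
    using Z by (auto simp: cover_def)
  then have "card E = card (\<Union>z\<in>Z. {e \<in> E. z \<in> V e})"
    by (rule arg_cong)
  also have "\<dots> \<le> (\<Sum>z\<in>Z. card {e \<in> E. z \<in> V e})"
    by (rule card_UN_le[OF finZ])
  also have "\<dots> \<le> (\<Sum>z\<in>Z. s)"
    using v Z by (intro sum_mono) (auto simp: cover_def)
  also have "\<dots> \<le> \<tau> * s"
    using \<open>card Z \<le> \<tau>\<close> by simp
  finally show False using large by simp
qed

section \<open>The arithmetical rank of monomial ideals\<close>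

text \<open>
  Each indeterminate in the generator \<open>q\<close> of \<open>ex_edge_of_high_degree_vertices\<close> divides more than
  \<open>s\<close> generators, so it divides one of any \<open>card M - s\<close> of them. The squarefree part of \<open>q\<close>
  belongs to the ideal because the ideal is radical, and it serves as the element \<open>u\<close> of
  \<open>ara_le_of_dvd_products\<close>.
\<close>

lemma ara_monomial_radical_le:
  fixes J M :: "('n::finite, 'k::field) mpoly set"
  assumes J: "ideal J mpoly_ring" and "M \<subseteq> monomials" and "finite M" and "M \<noteq> {}"
    and I: "rad_ideal mpoly_ring J = genideal mpoly_ring M"
  shows "ara mpoly_ring J
    \<le> card M - (card M - 1) div the_enat (max_height mpoly_ring (rad_ideal mpoly_ring J))"
proof -
  define \<tau> where "\<tau> = the_enat (max_height mpoly_ring (rad_ideal mpoly_ring J))"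
  define s where "s = (card M - 1) div \<tau>"
  define mon where "mon e = (Poly_Mapping.single e 1 :: ('n, 'k) mpoly)" for e
  define E where "E = {e. mon e \<in> M}"
  have inj: "inj mon"
  proof (rule injI)
    fix d e assume "mon d = mon e"
    then have "Poly_Mapping.keys (mon d) = Poly_Mapping.keys (mon e)" by simp
    then show "d = e" by (simp add: mon_def)
  qed
  have M: "M = mon ` E"
    using \<open>M \<subseteq> monomials\<close> by (auto simp: E_def monomials_def mon_def)
  have finE: "finite E"
    using \<open>finite M\<close> unfolding M by (rule finite_imageD) (rule inj_on_subset[OF inj], simp)
  have cardE: "card E = card M"
    unfolding M by (simp add: card_image inj_on_subset[OF inj])
  have "card M > 0"
    using \<open>finite M\<close> \<open>M \<noteq> {}\<close> by (simp add: card_gt_0_iff)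
  have "\<tau> * s \<le> card M - 1"
    unfolding s_def by simp
  then have large: "\<tau> * s < card E"
    using \<open>card M > 0\<close> cardE by linarith
  have min_cover: "card Z \<le> \<tau>"
    if "\<And>e. e \<in> E \<Longrightarrow> Poly_Mapping.keys e \<inter> Z \<noteq> {}"
      and "\<And>z. z \<in> Z \<Longrightarrow> \<exists>e\<in>E. Poly_Mapping.keys e \<inter> Z = {z}" for Z
  proof -
    have "M = (\<lambda>e. Poly_Mapping.single e 1) ` E"
      unfolding M mon_def ..
    then show ?thesis
      unfolding \<tau>_def I using card_minimal_cover_le_max_height[OF that, where 'k='k] by simp
  qed
  have "\<exists>q\<in>E. \<forall>x\<in>Poly_Mapping.keys q. s < card {e \<in> E. x \<in> Poly_Mapping.keys e}"
    by (rule ex_edge_of_high_degree_vertices[OF finE min_cover large])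
  then obtain q where q: "q \<in> E" and
    deg: "\<And>x. x \<in> Poly_Mapping.keys q \<Longrightarrow> s < card {e \<in> E. x \<in> Poly_Mapping.keys e}"
    by blast
  define u where "u = (\<Prod>x\<in>Poly_Mapping.keys q. indet x :: ('n, 'k) mpoly)"
  define t where "t = card M - s - 1"
  have "s \<le> card M - 1"
    unfolding s_def by (rule div_le_dividend)
  have "ara mpoly_ring J \<le> t + 1"
  proof (rule ara_le_of_dvd_products[OF J I \<open>finite M\<close>])
    \<comment> \<open>Any exponent that is at least all exponents of \<open>q\<close> serves here.\<close>
    let ?N = "\<Sum>x\<in>Poly_Mapping.keys q. Poly_Mapping.lookup q x"
    have "mon q dvd u ^ ?N"
      unfolding mon_def u_def monomial_eq_prod_indet prod_power_distrib
      by (intro prod_dvd_prod le_imp_power_dvd member_le_sum) auto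
    moreover have "mon q \<in> rad_ideal mpoly_ring J"
      unfolding I using subset_genideal_of_type[of M] q by (auto simp: E_def)
    ultimately have "u ^ ?N \<in> rad_ideal mpoly_ring J"
      using ideal_of_type_dvd[OF ideal_rad_ideal_of_type[OF J]] by blast
    then show "u \<in> rad_ideal mpoly_ring J"
      unfolding mem_rad_ideal_of_type by (metis power_mult)
  next
    fix B assume B: "B \<subseteq> M" "t < card B"
    define F where "F = {e. mon e \<in> B}"
    have "F \<subseteq> E"
      using B(1) by (auto simp: F_def E_def)
    have B_eq: "B = mon ` F"
      using B(1) by (auto simp: F_def M)
    have finF: "finite F"
      using finE \<open>F \<subseteq> E\<close> by (rule rev_finite_subset)
    have "card (E - F) \<le> s"
    proof -
      have "card F = card B"
        unfolding B_eq by (simp add: card_image inj_on_subset[OF inj])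
      then show ?thesis
        using B(2) cardE by (simp add: card_Diff_subset[OF finF \<open>F \<subseteq> E\<close>] t_def)
    qed
    have "x \<in> (\<Union>e\<in>F. Poly_Mapping.keys e)" if "x \<in> Poly_Mapping.keys q" for x
    proof (rule ccontr)
      assume "\<not> ?thesis"
      then have "{e \<in> E. x \<in> Poly_Mapping.keys e} \<subseteq> E - F" by auto
      then have "card {e \<in> E. x \<in> Poly_Mapping.keys e} \<le> card (E - F)"
        using finE by (intro card_mono) auto
      with deg[OF that] \<open>card (E - F) \<le> s\<close> show False by simp
    qed
    then have "Poly_Mapping.keys q \<subseteq> Poly_Mapping.keys (\<Sum>F)"
      using keys_sum_nat[OF finF, of id] by auto
    then have "u dvd mon (\<Sum>F)"
      unfolding u_def mon_def by (rule prod_indet_dvd_monomial)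
    also have "mon (\<Sum>F) = (\<Prod>e\<in>F. mon e)"
    proof -
      have mon_add: "mon (d + e) = mon d * mon e" for d e
        by (simp add: mon_def mult_single)
      have mon_0: "mon 0 = 1" by (simp add: mon_def)
      show ?thesis
        using finF by (induction F rule: finite_induct) (simp_all add: mon_add mon_0)
    qed
    also have "\<dots> = \<Prod>B"
      unfolding B_eq by (simp add: prod.reindex inj_on_subset[OF inj])
    finally show "u dvd \<Prod>B" .
  qed
  also have "t + 1 = card M - s"
    using \<open>s \<le> card M - 1\<close> \<open>card M > 0\<close> by (simp add: t_def)
  finally show ?thesis
    unfolding s_def \<tau>_def .
qed

theorem corollary2:
  fixes J I M :: "('n::finite, 'k::field) mpoly set"
  assumes "ideal J mpoly_ring"
    and "I = rad_ideal mpoly_ring J"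
    and "I \<noteq> {0}" and "I \<noteq> UNIV"
    and "M \<subseteq> monomials" and "finite M" and "card M \<le> CARD('n) - 1"
    and "I = genideal mpoly_ring M"
  shows "(of_nat (ara mpoly_ring J) :: rat)
    \<le> of_nat CARD('n) - (of_nat CARD('n) - 1) / of_nat (the_enat (max_height mpoly_ring I))"
proof -
  define \<tau> where "\<tau> = the_enat (max_height mpoly_ring I)"
  define \<mu> where "\<mu> = card M"
  have "M \<noteq> {}"
  proof
    assume "M = {}"
    have "ideal {0 :: ('n, 'k) mpoly} mpoly_ring"
      by (simp add: ideal_of_type_iff)
    then have "I \<subseteq> {0}"
      unfolding \<open>I = genideal mpoly_ring M\<close> \<open>M = {}\<close> by (rule genideal_of_type_least) simp
    moreover have "0 \<in> I"
      using ideal_genideal_of_type[of M] \<open>I = genideal mpoly_ring M\<close> by (simp add: ideal_of_type_iff)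
    ultimately show False using \<open>I \<noteq> {0}\<close> by blast
  qed
  then have \<mu>: "1 \<le> \<mu>" "\<mu> \<le> CARD('n) - 1"
    using assms(6,7) by (simp_all add: \<mu>_def Suc_le_eq card_gt_0_iff)
  have ara: "ara mpoly_ring J \<le> \<mu> - (\<mu> - 1) div \<tau>"
    using ara_monomial_radical_le[OF assms(1,5,6) \<open>M \<noteq> {}\<close>] assms(2,8)
    by (simp add: \<mu>_def \<tau>_def)
  show ?thesis
  \<comment> \<open>Division by zero yields zero, so for \<open>\<tau> = 0\<close> the right-hand side is the number of indeterminates.\<close>
  proof (cases "\<tau> = 0")
    case True
    then show ?thesis
      using ara \<mu> by (simp add: \<tau>_def)
  next
    case False
    let ?n = "of_nat CARD('n) :: rat" and ?m = "of_nat \<mu> :: rat" and ?t = "of_nat \<tau> :: rat"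
    have le: "(\<mu> - 1) div \<tau> \<le> \<mu>"
      by (meson diff_le_self div_le_dividend order_trans)
    have "\<mu> \<le> \<tau> * ((\<mu> - 1) div \<tau> + 1)"
    proof -
      have "\<mu> - 1 = \<tau> * ((\<mu> - 1) div \<tau>) + (\<mu> - 1) mod \<tau>" by simp
      moreover have "(\<mu> - 1) mod \<tau> < \<tau>" using False by simp
      ultimately show ?thesis
        unfolding distrib_left mult_1_right using \<mu>(1) by linarith
    qed
    then have "?m \<le> ?t * (of_nat ((\<mu> - 1) div \<tau>) + 1)"
      by (metis of_nat_1 of_nat_add of_nat_le_iff of_nat_mult)
    then have div: "?m / ?t \<le> of_nat ((\<mu> - 1) div \<tau>) + 1"
      using False by (simp add: field_simps)
    have "\<mu> + 1 \<le> CARD('n)"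
      using \<mu> by linarith
    then have "?m \<le> ?n - 1"
      by (metis le_diff_eq of_nat_1 of_nat_add of_nat_le_iff)
    moreover have "0 \<le> 1 - 1 / ?t"
      using False by (simp add: field_simps)
    ultimately have "?m * (1 - 1 / ?t) \<le> (?n - 1) * (1 - 1 / ?t)"
      by (rule mult_right_mono)
    moreover have "of_nat (ara mpoly_ring J) \<le> ?m - of_nat ((\<mu> - 1) div \<tau>)"
      using ara le by (metis of_nat_diff of_nat_le_iff)
    ultimately have "of_nat (ara mpoly_ring J) \<le> ?n - (?n - 1) / ?t"
      using div by (simp add: algebra_simps diff_divide_distrib)
    then show ?thesis unfolding \<tau>_def .
  qed
qed

end
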